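(* Let $q$ be a prime power and let $\delta$ be a positive integer. Then for each nonnegative integer $d_0$, $$\dim(P(\mathbb{F}_q)_{[d_0-\delta,d_0]})\le \min\left(910\,\frac{(\delta\log q)^3}{(\log \delta)^2},\;172\,\delta^3\log q\right).$$
   Context: $\log$ denotes the natural logarithm. $P(\mathbb{F}_q)_{[d_0-\delta,d_0]}$ denotes the poset of monic polynomials in $\mathbb{F}_q[x]$ with degree in the interval $[d_0-\delta,d_0]$, ordered by divisibility ($f\le g$ iff $f$ divides $g$). The Dushnik–Miller dimension $\dim(P)$ of a finite poset $P$ is the least $d\in\mathbb{N}$ such that $P$ embeds (is order-isomorphic to a suborder) into a product of $d$ chains (linear orders), where a product of posets carries the coordinatewise order. For $\delta=1$, where $\log\delta=0$, the first term of the minimum is read as $+\infty$, so that the bound is the second term. *)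

theory Defs
  imports
    Complex_Main
    "HOL-Library.FuncSet"
    "HOL-Computational_Algebra.Polynomial"
    "HOL-Number_Theory.Prime_Powers"
begin

text \<open>A poset is a pair of a carrier \<open>A\<close> and a relation \<open>r\<close> with \<^term>\<open>partial_order_on A r\<close>,
  where \<open>(x, y) \<in> r\<close> means \<open>x \<le> y\<close>; a chain is such a pair with \<^term>\<open>linear_order_on A r\<close>.\<close>

definition prod_order :: "nat \<Rightarrow> (nat \<Rightarrow> 'c set) \<Rightarrow> (nat \<Rightarrow> 'c rel) \<Rightarrow> (nat \<Rightarrow> 'c) rel" where
  "prod_order d C s = {(x, y). x \<in> (\<Pi>\<^sub>E i\<in>{..<d}. C i) \<and> y \<in> (\<Pi>\<^sub>E i\<in>{..<d}. C i)
     \<and> (\<forall>i<d. (x i, y i) \<in> s i)}"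

definition order_embedding ::
    "'a set \<Rightarrow> 'a rel \<Rightarrow> 'b set \<Rightarrow> 'b rel \<Rightarrow> ('a \<Rightarrow> 'b) \<Rightarrow> bool" where
  "order_embedding A r B t f \<longleftrightarrow> f \<in> A \<rightarrow> B \<and> inj_on f A
     \<and> (\<forall>x\<in>A. \<forall>y\<in>A. (x, y) \<in> r \<longleftrightarrow> (f x, f y) \<in> t)"

definition embeds_in_chains ::
    "'a set \<Rightarrow> 'a rel \<Rightarrow> nat \<Rightarrow> (nat \<Rightarrow> 'c set) \<Rightarrow> (nat \<Rightarrow> 'c rel) \<Rightarrow> bool" where
  "embeds_in_chains A r d C s \<longleftrightarrow> (\<forall>i<d. linear_order_on (C i) (s i))
     \<and> (\<exists>f. order_embedding A r (\<Pi>\<^sub>E i\<in>{..<d}. C i) (prod_order d C s) f)"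

text \<open>The chains range over linear orders on subsets of the element type of the poset itself.
  By \<open>embeds_in_chains_own_type\<close> below, chains on any other type would give the same dimension;
  by \<open>dm_dim_embeds\<close>, the minimum exists for every finite poset.\<close>

definition dm_dim :: "'a set \<Rightarrow> 'a rel \<Rightarrow> nat" where
  "dm_dim A r = (LEAST d. \<exists>(C :: nat \<Rightarrow> 'a set) s. embeds_in_chains A r d C s)"

text \<open>The lower end of the degree interval is an integer, possibly negative.\<close>

definition monic_polys :: "int \<Rightarrow> int \<Rightarrow> 'a::field poly set" where
  "monic_polys a b = {f. lead_coeff f = 1 \<and> int (degree f) \<in> {a..b}}"

definition dvd_on :: "'b::comm_semiring_1 set \<Rightarrow> 'b rel" where
  "dvd_on A = {(f, g). f \<in> A \<and> g \<in> A \<and> f dvd g}"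

lemma embeds_in_chains_own_type:
  fixes A :: "'a set" and C :: "nat \<Rightarrow> 'c set"
  assumes "embeds_in_chains A r d C s"
  shows "\<exists>(D :: nat \<Rightarrow> 'a set) t. embeds_in_chains A r d D t"
proof -
  from assms obtain f where lin: "\<And>i. i < d \<Longrightarrow> linear_order_on (C i) (s i)"
    and f: "f \<in> A \<rightarrow> (\<Pi>\<^sub>E i\<in>{..<d}. C i)" and inj: "inj_on f A"
    and iff: "\<And>x y. x \<in> A \<Longrightarrow> y \<in> A \<Longrightarrow> (x, y) \<in> r \<longleftrightarrow> (f x, f y) \<in> prod_order d C s"
    unfolding embeds_in_chains_def order_embedding_def by blast
  have fC: "f x i \<in> C i" if "x \<in> A" "i < d" for x i
    using f that by (auto simp: PiE_iff)
  define g where "g i = inv_into A (\<lambda>x. f x i)" for i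
  have gA: "g i (f x i) \<in> A" if "x \<in> A" for x i
    unfolding g_def using that by (intro inv_into_into) auto
  have fg: "f (g i (f x i)) i = f x i" if "x \<in> A" for x i
    unfolding g_def using that f_inv_into_f[of "f x i" "\<lambda>x. f x i" A] by auto
  define D where "D i = (\<lambda>x. g i (f x i)) ` A" for i
  define t where "t i = {(a, b). a \<in> D i \<and> b \<in> D i \<and> (f a i, f b i) \<in> s i}" for i
  define h where "h x = restrict (\<lambda>i. g i (f x i)) {..<d}" for x
  have DA: "D i \<subseteq> A" for i unfolding D_def using gA by auto
  have Dinj: "a = b" if "a \<in> D i" "b \<in> D i" "f a i = f b i" for a b i
    using that fg unfolding D_def by auto
  have "linear_order_on (D i) (t i)" if i: "i < d" for i
  proof -
    have l: "refl_on (C i) (s i)" "trans (s i)" "antisym (s i)" "total_on (C i) (s i)"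
      using lin[OF i] by (auto simp: order_on_defs)
    have c: "f a i \<in> C i" if "a \<in> D i" for a using that DA fC i by blast
    have "refl_on (D i) (t i)" using l(1) c by (auto simp: refl_on_def t_def)
    moreover have "trans (t i)" using l(2) unfolding trans_def t_def by blast
    moreover have "antisym (t i)"
      using l(3) Dinj unfolding antisym_def t_def by blast
    moreover have "total_on (D i) (t i)"
      using l(4) c Dinj unfolding total_on_def t_def by blast
    ultimately show ?thesis by (auto simp: order_on_defs t_def)
  qed
  moreover have "order_embedding A r (\<Pi>\<^sub>E i\<in>{..<d}. D i) (prod_order d D t) h"
    unfolding order_embedding_def
  proof (intro conjI ballI)
    show hD: "h \<in> A \<rightarrow> (\<Pi>\<^sub>E i\<in>{..<d}. D i)"
      by (auto simp: h_def D_def)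
    show "inj_on h A"
    proof (rule inj_onI)
      fix x y assume x: "x \<in> A" and y: "y \<in> A" and e: "h x = h y"
      have "f x i = f y i" if "i < d" for i
      proof -
        have "g i (f x i) = g i (f y i)" using fun_cong[OF e, of i] that by (simp add: h_def)
        then show ?thesis using fg x y by metis
      qed
      then have "f x = f y"
        using f x y by (intro PiE_ext[of "f x" "{..<d}" C "f y"]) auto
      then show "x = y" using inj x y by (auto dest: inj_onD)
    qed
    fix x y assume x: "x \<in> A" and y: "y \<in> A"
    have "(f x, f y) \<in> prod_order d C s \<longleftrightarrow> (\<forall>i<d. (f x i, f y i) \<in> s i)"
      using f x y by (auto simp: prod_order_def)
    moreover have "(h x, h y) \<in> prod_order d D t \<longleftrightarrow> (\<forall>i<d. (h x i, h y i) \<in> t i)"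
      using hD x y by (auto simp: prod_order_def)
    moreover have "(h x i, h y i) \<in> t i \<longleftrightarrow> (f x i, f y i) \<in> s i" if "i < d" for i
      using that x y by (auto simp: h_def t_def D_def fg)
    ultimately show "(x, y) \<in> r \<longleftrightarrow> (h x, h y) \<in> prod_order d D t"
      using iff[OF x y] by auto
  qed
  ultimately show ?thesis unfolding embeds_in_chains_def by blast
qed

lemma dm_dim_embeds:
  fixes A :: "'a set"
  assumes "finite A" and po: "partial_order_on A r"
  shows "\<exists>(C :: nat \<Rightarrow> 'a set) s. embeds_in_chains A r (dm_dim A r) C s"
proof -
  from ex_bij_betw_nat_finite[OF \<open>finite A\<close>] obtain e
    where e: "bij_betw e {0..<card A} A" by blast
  have eA: "e ` {..<card A} = A" using bij_betw_imp_surj_on[OF e] by (simp add: atLeast0LessThan)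
  define C where "C i = {0, 1 :: nat}" for i :: nat
  define s where "s i = {(a, b). a \<in> {0, 1 :: nat} \<and> b \<in> {0, 1} \<and> a \<le> b}" for i :: nat
  define f where "f x = restrict (\<lambda>i. if (e i, x) \<in> r then 1 else 0 :: nat) {..<card A}" for x
  have r: "refl_on A r" "trans r" "antisym r" "r \<subseteq> A \<times> A"
    using po by (auto simp: order_on_defs)
  have fC: "f x \<in> (\<Pi>\<^sub>E i\<in>{..<card A}. C i)" for x by (auto simp: f_def C_def)
  have key: "(x, y) \<in> r \<longleftrightarrow> (f x, f y) \<in> prod_order (card A) C s" if "x \<in> A" "y \<in> A" for x y
  proof -
    have "(f x, f y) \<in> prod_order (card A) C s
        \<longleftrightarrow> (\<forall>i\<in>{..<card A}. (e i, x) \<in> r \<longrightarrow> (e i, y) \<in> r)"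
      using fC by (auto simp: prod_order_def s_def f_def)
    also have "\<dots> \<longleftrightarrow> (\<forall>z\<in>A. (z, x) \<in> r \<longrightarrow> (z, y) \<in> r)"
      using ball_simps(9)[of e "{..<card A}" "\<lambda>z. (z, x) \<in> r \<longrightarrow> (z, y) \<in> r"] eA by simp
    also have "\<dots> \<longleftrightarrow> (x, y) \<in> r"
      using r(1,2) that unfolding refl_on_def trans_def by blast
    finally show ?thesis by simp
  qed
  have "inj_on f A"
  proof (rule inj_onI)
    fix x y assume a: "x \<in> A" "y \<in> A" "f x = f y"
    have "(x, x) \<in> r" "(y, y) \<in> r" using r(1) a by (auto simp: refl_on_def)
    then have "(x, y) \<in> r" "(y, x) \<in> r" using key a by metis+
    then show "x = y" using r(3) by (auto dest: antisymD)
  qed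
  moreover have "linear_order_on (C i) (s i)" for i
    by (auto simp: order_on_defs C_def s_def refl_on_def trans_def antisym_def total_on_def)
  ultimately have "embeds_in_chains A r (card A) C s"
    unfolding embeds_in_chains_def order_embedding_def using fC key by blast
  from embeds_in_chains_own_type[OF this] show ?thesis
    unfolding dm_dim_def by (rule LeastI)
qed

lemma finite_monic_polys: "finite (monic_polys a b :: 'a::{field,finite} poly set)"
proof (rule finite_subset)
  let ?L = "{xs :: 'a list. set xs \<subseteq> UNIV \<and> length xs \<le> Suc (nat b)}"
  show "finite (Poly ` ?L)" by (intro finite_imageI finite_lists_length_le) auto
  show "(monic_polys a b :: 'a poly set) \<subseteq> Poly ` ?L"
  proof
    fix f :: "'a poly" assume "f \<in> monic_polys a b"
    then have "length (coeffs f) \<le> Suc (nat b)"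
      by (auto simp: monic_polys_def length_coeffs_degree coeffs_def)
    then have "Poly (coeffs f) \<in> Poly ` ?L" by (intro imageI) auto
    then show "f \<in> Poly ` ?L" by simp
  qed
qed

lemma partial_order_on_monic_polys: "partial_order_on (monic_polys a b) (dvd_on (monic_polys a b :: 'b::field poly set))"
proof -
  have "f = g" if "lead_coeff f = 1" "lead_coeff g = 1" "f dvd g" "g dvd f" for f g :: "'b::field poly"
  proof -
    obtain k where k: "g = f * k" using \<open>f dvd g\<close> by (elim dvdE)
    have nz: "f \<noteq> 0" "g \<noteq> 0" using that by auto
    then have "degree g = degree f" using that by (intro antisym dvd_imp_degree_le) auto
    moreover have "k \<noteq> 0" using k nz by auto
    ultimately have "degree k = 0" using k nz by (simp add: degree_mult_eq)
    moreover have "lead_coeff k = 1" using that k by (simp add: lead_coeff_mult)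
    ultimately have "k = 1" using degree_0_id[of k] by (simp add: one_pCons)
    with k show ?thesis by simp
  qed
  then show ?thesis
    by (auto simp: order_on_defs dvd_on_def refl_on_def monic_polys_def
        intro!: transI antisymI intro: dvd_trans)
qed

end

theory Submission
  imports Defs "HOL-Library.Cardinality" "HOL-Analysis.Harmonic_Numbers"
    "HOL-Computational_Algebra.Polynomial_Factorial"
begin

text \<open>Write \<open>c\<close> for the difference of the exponent vectors of \<open>g\<close> and \<open>f\<close>. For a set \<open>T\<close> of
  irreducibles, ordering by the number of factors in \<open>T\<close> and breaking ties by an arbitrary order of
  the \<open>T\<close>-parts, or by its reverse, is compatible with divisibility; if neither order puts \<open>f\<close>
  above \<open>g\<close>, then \<open>c\<close> vanishes on \<open>T\<close> or has positive sum on \<open>T\<close>. Since \<open>g\<close> has degree at most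
  \<open>\<delta>\<close> more than \<open>f\<close>, these sums are bounded: if the irreducibles of degree between \<open>j\<^sub>0\<close> and \<open>\<delta>\<close> are
  distributed into buckets, at most \<open>k = \<delta> div j\<^sub>0\<close> buckets meet the support of \<open>c\<close>. Random
  distributions into \<open>8k\<close> buckets spread any \<open>2k\<close> irreducibles over more than \<open>k\<close> buckets, so the
  support has fewer than \<open>2k\<close> elements, and isolate each of its elements from the others, so
  \<open>c \<ge> 0\<close>. About \<open>k \<delta> log q\<close> distributions suffice, which gives \<open>k\<^sup>2 \<delta> log q\<close> orders, together with
  one for each irreducible of degree below \<open>j\<^sub>0\<close>. The two bounds are \<open>j\<^sub>0 = 1\<close> and
  \<open>q ^ j\<^sub>0 \<approx> \<delta>\<close>.\<close>

section \<open>Chain embeddings from integer-valued keys\<close>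

text \<open>Using the members of \<open>\<Phi>\<close> as coordinates embeds the poset into a
  product of \<open>card \<Phi>\<close> chains; injectivity is antisymmetry of \<open>r\<close>. The
  chains may live on any type \<open>'c\<close>, since \<open>embeds_in_chains_own_type\<close>
  moves them to the element type of the poset.\<close>

lemma dm_dim_le_card:
  fixes \<Phi> :: "('a \<Rightarrow> 'c::linorder) set"
  assumes "finite \<Phi>" and po: "partial_order_on A r"
    and key: "\<And>x y. x \<in> A \<Longrightarrow> y \<in> A \<Longrightarrow> (x, y) \<in> r \<longleftrightarrow> (\<forall>F\<in>\<Phi>. F x \<le> F y)"
  shows "dm_dim A r \<le> card \<Phi>"
proof -
  let ?d = "card \<Phi>"
  obtain e where "bij_betw e {0..<?d} \<Phi>"
    using ex_bij_betw_nat_finite[OF \<open>finite \<Phi>\<close>] by blast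
  then have e: "e ` {..<?d} = \<Phi>"
    by (simp add: bij_betw_def atLeast0LessThan)
  define C where "C i = (UNIV :: 'c set)" for i :: nat
  define s where "s i = {(a, b :: 'c). a \<le> b}" for i :: nat
  define f where "f x = restrict (\<lambda>i. e i x) {..<?d}" for x
  have fC: "f x \<in> (\<Pi>\<^sub>E i\<in>{..<?d}. C i)" for x by (auto simp: f_def C_def)
  have iff: "(x, y) \<in> r \<longleftrightarrow> (f x, f y) \<in> prod_order ?d C s" if "x \<in> A" "y \<in> A" for x y
  proof -
    have "(f x, f y) \<in> prod_order ?d C s \<longleftrightarrow> (\<forall>i\<in>{..<?d}. e i x \<le> e i y)"
      using fC by (auto simp: prod_order_def s_def f_def)
    also have "\<dots> \<longleftrightarrow> (\<forall>F\<in>e ` {..<?d}. F x \<le> F y)" by blast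
    finally show ?thesis using key[OF that] e by simp
  qed
  have "inj_on f A"
  proof (rule inj_onI)
    fix x y assume xy: "x \<in> A" "y \<in> A" "f x = f y"
    have "(x, x) \<in> r" "(y, y) \<in> r"
      using po xy(1,2) by (simp_all add: order_on_defs refl_on_def)
    then have "(x, y) \<in> r" "(y, x) \<in> r" using iff xy by simp_all
    moreover have "antisym r" using po by (simp add: order_on_defs)
    ultimately show "x = y" by (rule antisymD[rotated])
  qed
  moreover have "linear_order_on (C i) (s i)" for i
    by (auto simp: order_on_defs C_def s_def refl_on_def trans_def antisym_def total_on_def)
  ultimately have "embeds_in_chains A r ?d C s"
    unfolding embeds_in_chains_def order_embedding_def using fC iff
    by (intro conjI exI[of _ f]) auto
  from embeds_in_chains_own_type[OF this] show ?thesis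
    unfolding dm_dim_def by (rule Least_le)
qed

text \<open>Both keys sort by \<open>u\<close> first; \<open>F\<close> breaks ties by a numbering of
  the values of \<open>\<kappa>\<close> and \<open>G\<close> by the reverse numbering, so at equal
  \<open>u\<close> they agree only on equal values of \<open>\<kappa>\<close>.\<close>

lemma lex_keys_exist:
  fixes u :: "'x \<Rightarrow> nat" and \<kappa> :: "'x \<Rightarrow> 'k"
  assumes "finite P"
  shows "\<exists>(F :: 'x \<Rightarrow> int) (G :: 'x \<Rightarrow> int). \<forall>x\<in>P. \<forall>y\<in>P.
    F x \<le> F y \<and> G x \<le> G y \<longleftrightarrow> u x < u y \<or> u x = u y \<and> \<kappa> x = \<kappa> y"
proof -
  obtain e where "bij_betw e (\<kappa> ` P) {0..<card (\<kappa> ` P)}"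
    using ex_bij_betw_finite_nat[of "\<kappa> ` P"] assms by blast
  then have inj: "inj_on e (\<kappa> ` P)" and im: "e ` \<kappa> ` P = {0..<card (\<kappa> ` P)}"
    unfolding bij_betw_def by blast+
  define n where "n = card (\<kappa> ` P)"
  \<comment> \<open>The numbers \<open>e (\<kappa> x)\<close> are below \<open>n\<close>, so with
    the factor \<open>n\<close> the tie-break never outweighs a difference in
    \<open>u\<close>.\<close>
  define F where "F x = int (u x * n) + int (e (\<kappa> x))" for x
  define G where "G x = int (u x * n) - int (e (\<kappa> x))" for x
  have b: "e (\<kappa> x) < n" if "x \<in> P" for x
  proof -
    have "e (\<kappa> x) \<in> e ` \<kappa> ` P" using that by (intro imageI)
    then show ?thesis unfolding im n_def by simp
  qed
  have lt: "F x < F y \<and> G x < G y" if "x \<in> P" "y \<in> P" "u x < u y" for x y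
  proof -
    have "(u x + 1) * n \<le> u y * n" using that(3) by (intro mult_right_mono) auto
    then have "int (u x * n + n) \<le> int (u y * n)" by (simp only: of_nat_le_iff) simp
    moreover have "int (e (\<kappa> x)) < int n" "int (e (\<kappa> y)) < int n" using b that(1,2) by simp_all
    ultimately show ?thesis unfolding F_def G_def of_nat_add by simp
  qed
  have eq: "F x \<le> F y \<and> G x \<le> G y \<longleftrightarrow> \<kappa> x = \<kappa> y" if "x \<in> P" "y \<in> P" "u x = u y" for x y
  proof -
    have "F x \<le> F y \<and> G x \<le> G y \<longleftrightarrow> e (\<kappa> x) = e (\<kappa> y)"
      unfolding F_def G_def that(3) by linarith
    then show ?thesis using inj_on_eq_iff[OF inj] that(1,2) by simp
  qed
  have "F x \<le> F y \<and> G x \<le> G y \<longleftrightarrow> u x < u y \<or> u x = u y \<and> \<kappa> x = \<kappa> y"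
    if "x \<in> P" "y \<in> P" for x y
  proof (cases "u x" "u y" rule: linorder_cases)
    case less
    then show ?thesis using lt[OF that] by simp
  next
    case equal
    then show ?thesis using eq[OF that] by simp
  next
    case greater
    then show ?thesis using lt[OF that(2,1)] by simp
  qed
  then show ?thesis by blast
qed

section \<open>Hash families by counting\<close>

text \<open>Each bad set covers at most half of \<open>H\<close>, so on average a point of
  \<open>H\<close> lies in at most half of the bad sets. A point no worse than average is chosen,
  and the induction goes on with the bad sets that contain it, whose number is again below the
  halved bound.\<close>

lemma exists_tuple_avoiding_small_sets:
  assumes "finite H" "H \<noteq> {}" "finite \<B>"
    and "\<And>B. B \<in> \<B> \<Longrightarrow> B \<subseteq> H \<and> 2 * card B \<le> card H"
    and "card \<B> < 2 ^ N"
  shows "\<exists>hs :: nat \<Rightarrow> 'h. (\<forall>j<N. hs j \<in> H) \<and> (\<forall>B\<in>\<B>. \<exists>j<N. hs j \<notin> B)"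
  using assms(3-5)
proof (induction N arbitrary: \<B>)
  case 0
  then show ?case by auto
next
  case (Suc N)
  let ?c = "\<lambda>h. card {B \<in> \<B>. h \<in> B}"
  have "(\<Sum>h\<in>H. ?c h) = (\<Sum>B\<in>\<B>. card {h \<in> H. h \<in> B})"
    by (rule sum_multicount_gen[OF assms(1) Suc.prems(1)]) auto
  also have "\<dots> = (\<Sum>B\<in>\<B>. card B)"
    using Suc.prems(2) by (intro sum.cong arg_cong[where f = card]) auto
  finally have "2 * (\<Sum>h\<in>H. ?c h) = (\<Sum>B\<in>\<B>. 2 * card B)" by (simp add: sum_distrib_left)
  also have "\<dots> \<le> (\<Sum>B\<in>\<B>. card H)" using Suc.prems(2) by (intro sum_mono) auto
  also have "\<dots> < 2 ^ Suc N * card H"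
    using Suc.prems(3) assms(1,2) by (simp add: card_gt_0_iff)
  finally have lt: "(\<Sum>h\<in>H. ?c h) < 2 ^ N * card H" by simp
  have "\<exists>h\<in>H. ?c h < 2 ^ N"
  proof (rule ccontr)
    assume "\<not> ?thesis"
    then have "card H * 2 ^ N \<le> (\<Sum>h\<in>H. ?c h)"
      by (intro sum_bounded_below[of H "2 ^ N" ?c, simplified]) (auto simp: not_less)
    with lt show False by (simp add: mult.commute)
  qed
  then obtain h where h: "h \<in> H" "?c h < 2 ^ N" by blast
  obtain hs where hs: "\<forall>j<N. hs j \<in> H" "\<forall>B\<in>{B \<in> \<B>. h \<in> B}. \<exists>j<N. hs j \<notin> B"
    using Suc.IH[of "{B \<in> \<B>. h \<in> B}"] Suc.prems h(2) by auto
  have "\<exists>j<Suc N. (hs(N := h)) j \<notin> B" if "B \<in> \<B>" for B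
  proof (cases "h \<in> B")
    case True
    with hs(2) that obtain j where "j < N" "hs j \<notin> B" by blast
    then show ?thesis by (intro exI[of _ j]) auto
  qed auto
  moreover have "\<forall>j<Suc N. (hs(N := h)) j \<in> H" using hs(1) h(1) by (auto simp: less_Suc_eq)
  ultimately show ?case by blast
qed

text \<open>A function with \<open>h p = h x\<close> is determined by its values off
  \<open>p\<close>, which leaves at most a fraction 1/m of all functions.\<close>

lemma card_collide_le:
  fixes S :: "'p set"
  assumes "finite S" "p \<in> S" "x \<in> S" "p \<noteq> x"
  shows "m * card {h \<in> S \<rightarrow>\<^sub>E {..<m}. h p = h x} \<le> m ^ card S"
proof -
  let ?C = "{h \<in> S \<rightarrow>\<^sub>E {..<m}. h p = h x}"
  let ?f = "\<lambda>h. restrict h (S - {p})"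
  have "inj_on ?f ?C"
  proof (rule inj_onI)
    fix g h assume gh: "g \<in> ?C" "h \<in> ?C" "?f g = ?f h"
    have off: "g y = h y" if "y \<in> S" "y \<noteq> p" for y
      using fun_cong[OF gh(3), of y] that by simp
    have "g y = h y" if "y \<in> S" for y
      using off[of y] off[of x] gh(1,2) that assms by (cases "y = p") auto
    then show "g = h" using gh(1,2) by (intro PiE_ext[of g S "\<lambda>_. {..<m}" h]) auto
  qed
  moreover have "?f ` ?C \<subseteq> (S - {p}) \<rightarrow>\<^sub>E {..<m}"
    by (intro image_subsetI) (auto simp: restrict_PiE_iff)
  ultimately have "card ?C \<le> card ((S - {p}) \<rightarrow>\<^sub>E {..<m})"
    using assms(1) by (intro card_inj_on_le finite_PiE) auto
  also have "\<dots> = m ^ (card S - 1)" using assms by (simp add: card_funcsetE)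
  finally have "m * card ?C \<le> m * m ^ (card S - 1)" by simp
  also have "\<dots> = m ^ card S"
    using assms by (metis card_gt_0_iff empty_iff power_eq_if less_not_refl)
  finally show ?thesis .
qed

text \<open>Union bound over the possible collision partners of \<open>p\<close>.\<close>

lemma card_not_isolated_le:
  assumes "finite S" "p \<in> S" "X \<subseteq> S - {p}"
  shows "m * card {h \<in> S \<rightarrow>\<^sub>E {..<m}. h p \<in> h ` X} \<le> card X * m ^ card S"
proof -
  have fX: "finite X" using assms finite_subset by blast
  have "{h \<in> S \<rightarrow>\<^sub>E {..<m}. h p \<in> h ` X} = (\<Union>x\<in>X. {h \<in> S \<rightarrow>\<^sub>E {..<m}. h p = h x})" by auto
  also have "card \<dots> \<le> (\<Sum>x\<in>X. card {h \<in> S \<rightarrow>\<^sub>E {..<m}. h p = h x})"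
    by (rule card_UN_le[OF fX])
  finally have "m * card {h \<in> S \<rightarrow>\<^sub>E {..<m}. h p \<in> h ` X}
      \<le> m * (\<Sum>x\<in>X. card {h \<in> S \<rightarrow>\<^sub>E {..<m}. h p = h x})"
    by (rule mult_le_mono2)
  also have "\<dots> = (\<Sum>x\<in>X. m * card {h \<in> S \<rightarrow>\<^sub>E {..<m}. h p = h x})" by (rule sum_distrib_left)
  also have "\<dots> \<le> (\<Sum>x\<in>X. m ^ card S)"
    using assms by (intro sum_mono card_collide_le) auto
  finally show ?thesis by simp
qed

text \<open>Choose one representative in \<open>Y\<close> for each value of \<open>h\<close>. There
  are at most \<open>k\<close> of them, and each of the remaining elements, at least
  \<open>k\<close> in number, collides with its representative.\<close>

lemma card_image_le_imp_many_collide: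
  assumes "finite Y" "card Y = 2 * k" "card (h ` Y) \<le> k"
  shows "k \<le> card {y \<in> Y. h y \<in> h ` (Y - {y})}"
proof -
  define R where "R = inv_into Y h ` h ` Y"
  have "card R \<le> k" using assms card_image_le[of "h ` Y" "inv_into Y h"] unfolding R_def by simp
  moreover have "finite R" "R \<subseteq> Y"
    using assms(1) unfolding R_def by (auto intro: inv_into_into)
  ultimately have "k \<le> card (Y - R)" using assms(2) by (simp add: card_Diff_subset)
  also have "Y - R \<subseteq> {y \<in> Y. h y \<in> h ` (Y - {y})}"
  proof
    fix y assume y: "y \<in> Y - R"
    let ?z = "inv_into Y h (h y)"
    have "?z \<in> R" using y by (simp add: R_def)
    then have "?z \<in> Y - {y}" using y \<open>R \<subseteq> Y\<close> by auto
    moreover have "h y = h ?z" using y by (simp add: f_inv_into_f)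
    ultimately show "y \<in> {y \<in> Y. h y \<in> h ` (Y - {y})}" using y by blast
  qed
  then have "card (Y - R) \<le> card {y \<in> Y. h y \<in> h ` (Y - {y})}"
    using assms(1) by (intro card_mono) auto
  finally show ?thesis .
qed

text \<open>Markov's inequality for the number of colliding elements of \<open>Y\<close>: its mean
  is at most 2k * 2k / m, while each function counted here has at least \<open>k\<close> of them.
  This bounds the proportion of such functions by 4k / m.\<close>

lemma card_few_values_le:
  assumes "finite S" "Y \<subseteq> S" "card Y = 2 * k" "k > 0"
  shows "m * card {h \<in> S \<rightarrow>\<^sub>E {..<m}. card (h ` Y) \<le> k} \<le> 4 * k * m ^ card S"
proof -
  let ?H = "S \<rightarrow>\<^sub>E {..<m}"
  let ?B = "{h \<in> ?H. card (h ` Y) \<le> k}"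
  let ?coll = "\<lambda>h y. h y \<in> h ` (Y - {y})"
  have fY: "finite Y" and fH: "finite ?H" using assms finite_subset by (auto intro: finite_PiE)
  have "k * card ?B = (\<Sum>h\<in>?B. k)" by simp
  also have "\<dots> \<le> (\<Sum>h\<in>?B. card {y \<in> Y. ?coll h y})"
    by (intro sum_mono card_image_le_imp_many_collide[OF fY assms(3)]) auto
  also have "\<dots> \<le> (\<Sum>h\<in>?H. card {y \<in> Y. ?coll h y})"
    using fH by (intro sum_mono2) auto
  also have "\<dots> = (\<Sum>y\<in>Y. card {h \<in> ?H. ?coll h y})"
    by (rule sum_multicount_gen[OF fH fY]) auto
  finally have "m * (k * card ?B) \<le> m * (\<Sum>y\<in>Y. card {h \<in> ?H. ?coll h y})"
    by (rule mult_le_mono2)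
  also have "\<dots> = (\<Sum>y\<in>Y. m * card {h \<in> ?H. ?coll h y})" by (rule sum_distrib_left)
  also have "\<dots> \<le> (\<Sum>y\<in>Y. 2 * k * m ^ card S)"
  proof (rule sum_mono)
    fix y assume y: "y \<in> Y"
    have "m * card {h \<in> ?H. ?coll h y} \<le> card (Y - {y}) * m ^ card S"
      using assms y by (intro card_not_isolated_le) auto
    also have "\<dots> \<le> 2 * k * m ^ card S"
      using assms(3) fY y by (intro mult_right_mono) (auto simp: card_Diff_singleton)
    finally show "m * card {h \<in> ?H. ?coll h y} \<le> 2 * k * m ^ card S" .
  qed
  also have "\<dots> = k * (4 * k * m ^ card S)" using assms(3) by simp
  finally have "k * (m * card ?B) \<le> k * (4 * k * m ^ card S)" by (simp only: mult.left_commute)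
  then show ?thesis using assms(4) by simp
qed

text \<open>With 8k values, failing to isolate has probability at most 1/4 and failing to spread at
  most 1/2. Indexing the failures by lists of length 2k gives at most
  \<open>2 * card S ^ (2 * k)\<close> bad sets, so \<open>exists_tuple_avoiding_small_sets\<close>
  applies.\<close>

lemma hash_family_exists:
  fixes S :: "'p set"
  assumes "finite S" "k > 0" and N: "2 * card S ^ (2 * k) < 2 ^ N"
  shows "\<exists>hs :: nat \<Rightarrow> 'p \<Rightarrow> nat. (\<forall>j<N. \<forall>p\<in>S. hs j p < 8 * k)
    \<and> (\<forall>p\<in>S. \<forall>X. X \<subseteq> S - {p} \<and> card X < 2 * k \<longrightarrow> (\<exists>j<N. hs j p \<notin> hs j ` X))
    \<and> (\<forall>Y. Y \<subseteq> S \<and> card Y = 2 * k \<longrightarrow> (\<exists>j<N. k < card (hs j ` Y)))"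
proof -
  let ?m = "8 * k" and ?n = "card S"
  let ?H = "S \<rightarrow>\<^sub>E {..<?m}"
  define L where "L = {xs. set xs \<subseteq> S \<and> length xs = 2 * k}"
  \<comment> \<open>The head of the list is the point to isolate; its other distinct entries form
    the set to isolate it from.\<close>
  define iso where "iso xs = {h \<in> ?H. h (hd xs) \<in> h ` (set xs - {hd xs})}" for xs
  \<comment> \<open>A list with repeated entries gets the empty, hence harmless, bad set.\<close>
  define few where "few xs = {h \<in> ?H. card (set xs) = 2 * k \<and> card (h ` set xs) \<le> k}" for xs
  define \<B> where "\<B> = iso ` L \<union> few ` L"
  have fL: "finite L" "card L = ?n ^ (2 * k)"
    using assms(1) by (auto simp: L_def finite_lists_length_eq card_lists_length_eq)
  have f\<B>: "finite \<B>" using fL(1) by (simp add: \<B>_def)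
  have fH: "finite ?H" using assms(1) by (auto intro: finite_PiE)
  have cH: "card ?H = ?m ^ ?n" using assms(1) by (simp add: card_funcsetE)
  have "card \<B> \<le> card L + card L"
    unfolding \<B>_def using card_Un_le[of "iso ` L" "few ` L"]
      card_image_le[OF fL(1), of iso] card_image_le[OF fL(1), of few] by linarith
  then have c\<B>: "card \<B> < 2 ^ N" using N fL(2) by simp
  have small: "B \<subseteq> ?H \<and> 2 * card B \<le> card ?H" if "B \<in> \<B>" for B
  proof -
    have "8 * k * (2 * card B) \<le> 8 * k * card ?H"
    proof -
      from that consider xs where "xs \<in> L" "B = iso xs" | xs where "xs \<in> L" "B = few xs"
        unfolding \<B>_def by blast
      then show ?thesis
      proof cases
        case 1
        have "xs \<noteq> []" using 1 assms(2) by (auto simp: L_def)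
        then have hd: "hd xs \<in> set xs" by simp
        have "card (set xs - {hd xs}) \<le> 2 * k"
          using 1(1) card_length[of xs] hd by (auto simp: L_def)
        moreover have "?m * card B \<le> card (set xs - {hd xs}) * ?m ^ ?n"
          unfolding 1 iso_def using 1(1) hd assms(1) by (intro card_not_isolated_le) (auto simp: L_def)
        ultimately have "?m * card B \<le> 2 * k * ?m ^ ?n"
          by (meson mult_le_mono1 order_trans)
        also have "\<dots> \<le> 4 * k * ?m ^ ?n" by simp
        finally show ?thesis by (simp add: cH)
      next
        case 2
        show ?thesis
        proof (cases "card (set xs) = 2 * k")
          case True
          then have "?m * card B \<le> 4 * k * ?m ^ ?n"
            unfolding 2 few_def using card_few_values_le[of S "set xs" k ?m] 2(1) assms
            by (simp add: L_def)
          then show ?thesis by (simp add: cH)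
        qed (simp add: 2 few_def)
      qed
    qed
    moreover have "B \<subseteq> ?H" using that by (auto simp: \<B>_def iso_def few_def)
    ultimately show ?thesis using assms(2) by simp
  qed
  have "?H \<noteq> {}" using assms(2) by (auto simp: PiE_eq_empty_iff lessThan_empty_iff)
  then obtain hs where hs: "\<forall>j<N. hs j \<in> ?H" "\<forall>B\<in>\<B>. \<exists>j<N. hs j \<notin> B"
    using exists_tuple_avoiding_small_sets[OF fH _ f\<B> small c\<B>] by blast
  have isolate: "\<exists>j<N. hs j p \<notin> hs j ` X" if "p \<in> S" "X \<subseteq> S - {p}" "card X < 2 * k" for p X
  proof -
    have "finite X" using that assms(1) finite_subset by blast
    then obtain xs where xs: "set xs = X" "distinct xs" using finite_distinct_list by blast
    \<comment> \<open>Padding with copies of \<open>p\<close> brings the list to length 2k. As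
      \<open>card X < 2 * k\<close>, at least one copy is added, so \<open>p\<close> is the
      head.\<close>
    define ys where "ys = replicate (2 * k - length xs) p @ xs"
    have len: "length xs < 2 * k" using xs that(3) distinct_card[of xs] by simp
    then have "ys \<in> L" "hd ys = p" "set ys - {p} = X"
      using xs that by (auto simp: ys_def L_def hd_append)
    moreover from this obtain j where "j < N" "hs j \<notin> iso ys"
      using hs(2) unfolding \<B>_def by blast
    ultimately show ?thesis using hs(1) by (intro exI[of _ j]) (simp add: iso_def)
  qed
  have spread: "\<exists>j<N. k < card (hs j ` Y)" if "Y \<subseteq> S" "card Y = 2 * k" for Y
  proof -
    have "finite Y" using that assms(1) finite_subset by blast
    then obtain xs where xs: "set xs = Y" "distinct xs" using finite_distinct_list by blast
    then have "xs \<in> L" using that distinct_card[of xs] by (simp add: L_def)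
    then obtain j where "j < N" "hs j \<notin> few xs"
      using hs(2) unfolding \<B>_def by blast
    then show ?thesis using hs(1) xs that
      by (intro exI[of _ j]) (simp add: few_def not_le)
  qed
  show ?thesis
  proof (intro exI[of _ hs] conjI ballI allI impI)
    show "hs j p < 8 * k" if "j < N" "p \<in> S" for j p
      using hs(1) that by (auto simp: PiE_iff)
    show "\<exists>j<N. hs j p \<notin> hs j ` X" if "p \<in> S" "X \<subseteq> S - {p} \<and> card X < 2 * k" for p X
      using isolate[of p X] that by simp
    show "\<exists>j<N. k < card (hs j ` Y)" if "Y \<subseteq> S \<and> card Y = 2 * k" for Y
      using spread[of Y] that by simp
  qed
qed


section \<open>From a hash family to a bound on the dimension\<close>

lemma size_filter_eq_sum_fibres:
  assumes "\<And>p. p \<in> S \<Longrightarrow> h p < (n::nat)"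
  shows "size (filter_mset (\<lambda>p. p \<in> S) M)
    = (\<Sum>i<n. size (filter_mset (\<lambda>p. p \<in> S \<and> h p = i) M))"
proof (induction M)
  case (add p M)
  have "(\<Sum>i<n. size (filter_mset (\<lambda>p. p \<in> S \<and> h p = i) (add_mset p M)))
     = (\<Sum>i<n. size (filter_mset (\<lambda>p. p \<in> S \<and> h p = i) M)
          + (if i = h p then if p \<in> S then 1 else 0 else 0))"
    by (intro sum.cong) auto
  also have "\<dots> = size (filter_mset (\<lambda>p. p \<in> S) M) + (if p \<in> S then 1 else 0)"
    using assms[of p] by (simp add: sum.distrib add)
  finally show ?case by simp
qed simp

text \<open>Here \<open>v\<close> plays the role of factorization into irreducibles and
  \<open>w\<close> that of the degree. In the bound, 3 counts the map \<open>g\<close> and the two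
  keys of the class outside \<open>S\<^sub>0\<close> and \<open>S\<close>; each member of
  \<open>S\<^sub>0\<close> has its own coordinate, and each of the \<open>N * m\<close> buckets has
  two keys.\<close>

lemma dm_dim_le_of_hash_family:
  fixes v :: "'x \<Rightarrow> 'p multiset" and w :: "'p \<Rightarrow> nat"
  assumes "finite P" and po: "partial_order_on P r"
    and r_iff: "\<And>x y. x \<in> P \<Longrightarrow> y \<in> P \<Longrightarrow> (x, y) \<in> r \<longleftrightarrow> v x \<subseteq># v y"
    and window: "\<And>x y. x \<in> P \<Longrightarrow> y \<in> P \<Longrightarrow> (\<Sum>p\<in>#v y. w p) \<le> (\<Sum>p\<in>#v x. w p) + \<delta>"
    and "finite S\<^sub>0" "finite S" "S\<^sub>0 \<inter> S = {}"
    and large: "\<And>x p. x \<in> P \<Longrightarrow> p \<in># v x \<Longrightarrow> p \<notin> S\<^sub>0 \<union> S \<Longrightarrow> \<delta> < w p"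
    and "j\<^sub>0 > 0" and medium: "\<And>p. p \<in> S \<Longrightarrow> j\<^sub>0 \<le> w p"
    and k: "k = \<delta> div j\<^sub>0" and "N > 0"
    and range: "\<And>j p. j < N \<Longrightarrow> p \<in> S \<Longrightarrow> hs j p < m"
    and isolate: "\<And>p X. p \<in> S \<Longrightarrow> X \<subseteq> S - {p} \<Longrightarrow> card X < 2 * k \<Longrightarrow> \<exists>j<N. hs j p \<notin> hs j ` X"
    and spread: "\<And>Y. Y \<subseteq> S \<Longrightarrow> card Y = 2 * k \<Longrightarrow> \<exists>j<N. k < card (hs j ` Y)"
  shows "dm_dim P r \<le> 3 + card S\<^sub>0 + 2 * (N * m)"
proof -
  define part where "part T x = filter_mset (\<lambda>p. p \<in> T) (v x)" for T x
  define u where "u T x = size (part T x)" for T x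
  have "\<forall>T. \<exists>FG :: ('x \<Rightarrow> int) \<times> ('x \<Rightarrow> int). \<forall>x\<in>P. \<forall>y\<in>P.
    fst FG x \<le> fst FG y \<and> snd FG x \<le> snd FG y \<longleftrightarrow> u T x < u T y \<or> u T x = u T y \<and> part T x = part T y"
  proof
    fix T
    obtain F G :: "'x \<Rightarrow> int" where "\<forall>x\<in>P. \<forall>y\<in>P.
      F x \<le> F y \<and> G x \<le> G y \<longleftrightarrow> u T x < u T y \<or> u T x = u T y \<and> part T x = part T y"
      using lex_keys_exist[OF assms(1), of "u T" "part T"] by blast
    then show "\<exists>FG :: ('x \<Rightarrow> int) \<times> ('x \<Rightarrow> int). \<forall>x\<in>P. \<forall>y\<in>P.
      fst FG x \<le> fst FG y \<and> snd FG x \<le> snd FG y \<longleftrightarrow> u T x < u T y \<or> u T x = u T y \<and> part T x = part T y"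
      by (intro exI[of _ "(F, G)"]) simp
  qed
  from choice[OF this] obtain FG :: "'p set \<Rightarrow> ('x \<Rightarrow> int) \<times> ('x \<Rightarrow> int)" where
    FG: "\<And>T x y. x \<in> P \<Longrightarrow> y \<in> P \<Longrightarrow> fst (FG T) x \<le> fst (FG T) y \<and> snd (FG T) x \<le> snd (FG T) y
      \<longleftrightarrow> u T x < u T y \<or> u T x = u T y \<and> part T x = part T y"
    by blast
  define L where "L = - (S\<^sub>0 \<union> S)"
  define B where "B ji = {p. p \<in> S \<and> hs (fst ji) p = snd ji}" for ji
  define \<T> where "\<T> = insert L (B ` ({..<N} \<times> {..<m}))"
  \<comment> \<open>\<open>c p\<close> is a lower bound for \<open>w p\<close> in the class of
    \<open>p\<close>, so the truncated difference \<open>w p - c p\<close> is exact for every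
    \<open>p\<close> that occurs in some \<open>v x\<close> with \<open>x \<in> P\<close>.\<close>
  define c where "c p = (if p \<in> S then j\<^sub>0 else if p \<in> S\<^sub>0 then 0 else Suc \<delta>)" for p
  define g where "g x = int (\<Sum>p\<in>#v x. w p - c p)" for x
    \<comment> \<open>Total weight minus \<open>j\<^sub>0\<close> times the count in \<open>S\<close> minus \<open>Suc \<delta>\<close> times the count in \<open>L\<close>: its
      monotonicity turns the bound on the weight into a bound on the counts.\<close>
  define \<Phi> where "\<Phi> = insert g ((\<lambda>p x. int (count (v x) p)) ` S\<^sub>0) \<union> (fst ` FG ` \<T> \<union> snd ` FG ` \<T>)"
  have \<T>: "finite \<T>" "card \<T> \<le> Suc (N * m)"
  proof -
    show "finite \<T>" by (simp add: \<T>_def)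
    have "card \<T> \<le> Suc (card (B ` ({..<N} \<times> {..<m})))" unfolding \<T>_def by (rule card_insert_le_m1) auto
    also have "\<dots> \<le> Suc (N * m)"
      using card_image_le[of "{..<N} \<times> {..<m}" B] by (simp add: card_cartesian_product)
    finally show "card \<T> \<le> Suc (N * m)" .
  qed
  have "finite \<Phi>" using \<T>(1) \<open>finite S\<^sub>0\<close> by (simp add: \<Phi>_def)
  have card_\<Phi>: "card \<Phi> \<le> 3 + card S\<^sub>0 + 2 * (N * m)"
  proof -
    let ?C = "(\<lambda>p x. int (count (v x) p)) ` S\<^sub>0"
    have "card (insert g ?C) \<le> Suc (card S\<^sub>0)"
      using card_image_le[OF \<open>finite S\<^sub>0\<close>, of "\<lambda>p x. int (count (v x) p)"] \<open>finite S\<^sub>0\<close>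
      by (simp add: card_insert_if)
    moreover have "card (fst ` FG ` \<T>) \<le> card \<T>" "card (snd ` FG ` \<T>) \<le> card \<T>"
      unfolding image_image using card_image_le[OF \<T>(1)] by auto
    ultimately show ?thesis
      using \<T>(2) card_Un_le[of "insert g ?C" "fst ` FG ` \<T> \<union> snd ` FG ` \<T>"]
        card_Un_le[of "fst ` FG ` \<T>" "snd ` FG ` \<T>"] unfolding \<Phi>_def by linarith
  qed
  have "(x, y) \<in> r \<longleftrightarrow> (\<forall>F\<in>\<Phi>. F x \<le> F y)" if x: "x \<in> P" and y: "y \<in> P" for x y
  proof
    assume "(x, y) \<in> r"
    then have "v x \<subseteq># v y" using r_iff x y by simp
    then obtain d where d: "v y = v x + d" by (auto simp: subset_mset.le_iff_add)
    have "fst (FG T) x \<le> fst (FG T) y \<and> snd (FG T) x \<le> snd (FG T) y" for T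
      unfolding FG[OF x y] by (auto simp: u_def part_def d)
    moreover have "g x \<le> g y" unfolding g_def d by (simp only: of_nat_le_iff) simp
    ultimately show "\<forall>F\<in>\<Phi>. F x \<le> F y" by (auto simp: \<Phi>_def d)
  next
    assume all: "\<forall>F\<in>\<Phi>. F x \<le> F y"
    have bucket: "u T x < u T y \<or> part T x = part T y" if "T \<in> \<T>" for T
    proof -
      have "fst (FG T) \<in> \<Phi>" "snd (FG T) \<in> \<Phi>" using that by (auto simp: \<Phi>_def)
      then have "fst (FG T) x \<le> fst (FG T) y \<and> snd (FG T) x \<le> snd (FG T) y" using all by blast
      then show ?thesis unfolding FG[OF x y] by blast
    qed
    have B_bucket: "B (j, i) \<in> \<T>" if "j < N" "i < m" for j i using that by (auto simp: \<T>_def)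
    have count_part: "count (part T z) p = (if p \<in> T then count (v z) p else 0)" for T z p
      by (simp add: part_def)
    define X where "X = {p \<in> S. count (v x) p \<noteq> count (v y) p}"
    have X: "X \<subseteq> S" "finite X" using \<open>finite S\<close> by (auto simp: X_def)
    \<comment> \<open>No bucket loses elements from \<open>x\<close> to \<open>y\<close>, and a
      bucket that meets \<open>X\<close> has different parts in \<open>x\<close> and
      \<open>y\<close>, so it must gain at least one.\<close>
    have S_growth: "u S x + card (hs j ` X) \<le> u S y" if j: "j < N" for j
    proof -
      have fib: "u S z = (\<Sum>i<m. u (B (j, i)) z)" for z
        unfolding u_def part_def B_def using size_filter_eq_sum_fibres[of S "hs j" m "v z"] range j
        by simp
      have "hs j ` X \<subseteq> {..<m}" using X range[OF j] by auto
      then have "card (hs j ` X) = (\<Sum>i<m. if i \<in> hs j ` X then 1 else 0)"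
        by (simp add: sum.If_cases Int_absorb1)
      then have "u S x + card (hs j ` X) = (\<Sum>i<m. u (B (j, i)) x + (if i \<in> hs j ` X then 1 else 0))"
        by (simp add: fib sum.distrib)
      also have "\<dots> \<le> (\<Sum>i<m. u (B (j, i)) y)"
      proof (rule sum_mono)
        fix i assume "i \<in> {..<m}"
        then have b: "u (B (j, i)) x < u (B (j, i)) y \<or> part (B (j, i)) x = part (B (j, i)) y"
          using bucket B_bucket j by simp
        show "u (B (j, i)) x + (if i \<in> hs j ` X then 1 else 0) \<le> u (B (j, i)) y"
        proof (cases "i \<in> hs j ` X")
          case True
          then obtain p where p: "p \<in> X" "hs j p = i" by blast
          then have "p \<in> B (j, i)" using X by (auto simp: B_def)
          then have "part (B (j, i)) x \<noteq> part (B (j, i)) y"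
            using p count_part[of "B (j, i)" x p] count_part[of "B (j, i)" y p] by (auto simp: X_def)
          then show ?thesis using b True by simp
        next
          case False
          then show ?thesis using b by (auto simp: u_def)
        qed
      qed
      finally show ?thesis by (simp add: fib)
    qed
    have L_le: "u L x \<le> u L y" using bucket[of L] by (auto simp: \<T>_def u_def)
    have weight: "(\<Sum>p\<in>#v z. w p) = (\<Sum>p\<in>#v z. w p - c p) + j\<^sub>0 * u S z + Suc \<delta> * u L z"
      if "z \<in> P" for z
    proof -
      have "(\<Sum>p\<in>#M. w p) = (\<Sum>p\<in>#M. w p - c p) + j\<^sub>0 * size (filter_mset (\<lambda>p. p \<in> S) M)
          + Suc \<delta> * size (filter_mset (\<lambda>p. p \<in> L) M)" if "set_mset M \<subseteq> set_mset (v z)" for M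
        using that
      proof (induction M)
        case (add p M)
        have pz: "p \<in># v z" and M: "set_mset M \<subseteq> set_mset (v z)" using add.prems by auto
        have "w p = (w p - c p) + (if p \<in> S then j\<^sub>0 else 0) + (if p \<in> L then Suc \<delta> else 0)"
          using medium[of p] large[OF \<open>z \<in> P\<close> pz] \<open>S\<^sub>0 \<inter> S = {}\<close> by (auto simp: c_def L_def)
        then show ?case using add.IH[OF M] by (auto split: if_splits)
      qed simp
      from this[of "v z"] show ?thesis by (simp only: u_def part_def)
    qed
    have "g x \<le> g y" using all by (simp add: \<Phi>_def)
    then have "(\<Sum>p\<in>#v x. w p - c p) \<le> (\<Sum>p\<in>#v y. w p - c p)"
      by (simp only: g_def of_nat_le_iff)
    \<comment> \<open>The total weight grows by at most \<delta> and the share measured by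
      \<open>g\<close> does not shrink, so the weighted counts in \<open>S\<close> and
      \<open>L\<close> together grow by at most \<delta>.\<close>
    then have main: "j\<^sub>0 * u S y + Suc \<delta> * u L y \<le> j\<^sub>0 * u S x + Suc \<delta> * u L x + \<delta>"
      using window[OF x y] weight[OF x] weight[OF y] by linarith
    have S_le: "u S x \<le> u S y" using S_growth[OF \<open>N > 0\<close>] by simp
    \<comment> \<open>One more element of \<open>L\<close> would cost \<open>Suc \<delta>\<close>,
      beyond the allowance of \<delta>.\<close>
    have "u L y = u L x"
    proof (rule ccontr)
      assume "u L y \<noteq> u L x"
      then have "Suc \<delta> * Suc (u L x) \<le> Suc \<delta> * u L y" using L_le by (intro mult_le_mono2) simp
      moreover have "j\<^sub>0 * u S x \<le> j\<^sub>0 * u S y" using S_le by simp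
      ultimately show False using main unfolding mult_Suc_right by linarith
    qed
    then have L_eq: "part L x = part L y" using bucket[of L] by (auto simp: \<T>_def)
    \<comment> \<open>Each bucket that meets \<open>X\<close> uses up at least
      \<open>j\<^sub>0\<close> of the allowance \<delta>.\<close>
    have few: "card (hs j ` X) \<le> k" if "j < N" for j
    proof -
      have "j\<^sub>0 * (u S x + card (hs j ` X)) \<le> j\<^sub>0 * u S y" using S_growth[OF that] by (rule mult_le_mono2)
      then have "card (hs j ` X) * j\<^sub>0 \<le> \<delta>"
        using main \<open>u L y = u L x\<close> by (simp add: algebra_simps)
      then show ?thesis using \<open>j\<^sub>0 > 0\<close> unfolding k by (simp add: less_eq_div_iff_mult_less_eq)
    qed
    have card_X: "card X < 2 * k"
    proof (rule ccontr)
      assume "\<not> ?thesis"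
      then obtain Y where Y: "Y \<subseteq> X" "card Y = 2 * k" using obtain_subset_with_card_n[of "2 * k" X] by auto
      then obtain j where "j < N" "k < card (hs j ` Y)" using spread[of Y] X by auto
      moreover have "card (hs j ` Y) \<le> card (hs j ` X)" using Y X by (intro card_mono) auto
      ultimately show False using few[of j] by simp
    qed
    have "count (v x) p \<le> count (v y) p" for p
    proof -
      consider "p \<in> L" | "p \<in> S\<^sub>0" | "p \<in> S" by (auto simp: L_def)
      then show ?thesis
      proof cases
        case 1
        then show ?thesis using count_part[of L x p] count_part[of L y p] L_eq by simp
      next
        case 2
        then have "(\<lambda>x. int (count (v x) p)) \<in> \<Phi>" by (simp add: \<Phi>_def)
        then show ?thesis using all by fastforce
      next
        case 3
        \<comment> \<open>In a distribution that isolates \<open>p\<close> from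
          \<open>X - {p}\<close>, every other element of the bucket of \<open>p\<close> has the same
          multiplicity in \<open>x\<close> and \<open>y\<close>. Comparing the bucket sizes then
          compares the multiplicities of \<open>p\<close>.\<close>
        have "card (X - {p}) < 2 * k" using card_X card_Diff1_le[of X p] by linarith
        then obtain j where j: "j < N" "hs j p \<notin> hs j ` (X - {p})"
          using isolate[of p "X - {p}"] 3 X by blast
        let ?T = "B (j, hs j p)"
        have only: "part ?T z = part {p} z + part (?T - {p}) z" for z
          using 3 by (intro multiset_eqI) (auto simp: count_part B_def)
        have "part (?T - {p}) x = part (?T - {p}) y"
        proof (rule multiset_eqI)
          fix q
          show "count (part (?T - {p}) x) q = count (part (?T - {p}) y) q"
          proof (cases "q \<in> ?T - {p}")
            case True
            then have "q \<notin> X" using j(2) by (auto simp: B_def intro: rev_image_eqI)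
            then show ?thesis using True by (simp add: count_part X_def B_def)
          qed (simp only: count_part if_False)
        qed
        moreover have "u ?T x \<le> u ?T y"
          using bucket[OF B_bucket[OF j(1) range[OF j(1) 3]]] by (auto simp: u_def)
        moreover have "part {p} z = replicate_mset (count (v z) p) p" for z
          by (intro multiset_eqI) (auto simp: count_part)
        ultimately show ?thesis by (simp add: u_def only)
      qed
    qed
    then show "(x, y) \<in> r" using r_iff[OF x y] by (simp add: subseteq_mset_def)
  qed
  then have "dm_dim P r \<le> card \<Phi>" by (intro dm_dim_le_card[OF \<open>finite \<Phi>\<close> po])
  with card_\<Phi> show ?thesis by simp
qed

section \<open>Factorization of monic polynomials over a field\<close>

lemma monic_irreducible_dvd_imp_eq:
  fixes p n :: "'a::field poly"
  assumes "irreducible p" "lead_coeff p = 1" "irreducible n" "lead_coeff n = 1" "p dvd n"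
  shows "p = n"
proof -
  obtain u where u: "n = p * u" using assms(5) by (elim dvdE)
  then have "u dvd 1" using assms(1,3) irreducibleD irreducible_not_unit by blast
  then obtain c where c: "u = [:c:]" by (auto simp: is_unit_poly_iff)
  have "lead_coeff n = c * lead_coeff p" unfolding u c lead_coeff_mult by simp
  then have "c = 1" using assms(2,4) by simp
  then show ?thesis using u c by simp
qed

text \<open>Irreducibles over a field are prime, so a factor \<open>p\<close> of the left product
  divides some factor on the right and, both being monic, equals it. Cancelling \<open>p\<close> on
  both sides drives the induction.\<close>

lemma prod_mset_monic_irreducible_dvd_iff:
  fixes M N :: "'a::field poly multiset"
  assumes "\<And>p. p \<in># M \<Longrightarrow> irreducible p \<and> lead_coeff p = 1"
    and "\<And>p. p \<in># N \<Longrightarrow> irreducible p \<and> lead_coeff p = 1"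
  shows "prod_mset M dvd prod_mset N \<longleftrightarrow> M \<subseteq># N"
proof
  show "M \<subseteq># N" if "prod_mset M dvd prod_mset N"
    using that assms
  proof (induction M arbitrary: N)
    case (add p M)
    have p: "irreducible p" "lead_coeff p = 1" using add.prems(2) by auto
    have "p dvd prod_mset N" using add.prems(1) by (auto intro: dvd_mult_left)
    then obtain n where n: "n \<in># N" "p dvd n"
      using prime_elem_dvd_prod_msetE[OF field_poly_irreducible_imp_prime[OF p(1)]] by blast
    then have "p = n" using p add.prems(3) monic_irreducible_dvd_imp_eq by blast
    then obtain N' where N': "N = add_mset p N'" using n(1) by (blast dest: multi_member_split)
    have "p \<noteq> 0" using p(2) by auto
    then have "prod_mset M dvd prod_mset N'" using add.prems(1) unfolding N' by simp
    then have "M \<subseteq># N'" using add.IH[of N'] add.prems(2,3) unfolding N' by auto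
    then show ?case unfolding N' by simp
  qed simp
qed (rule prod_mset_subset_imp_dvd)

lemma monic_factorization_exists:
  fixes f :: "'a::field poly"
  assumes "lead_coeff f = 1"
  shows "\<exists>M. (\<forall>p\<in>#M. irreducible p \<and> lead_coeff p = 1) \<and> prod_mset M = f"
  using assms
proof (induction "degree f" arbitrary: f rule: less_induct)
  case less
  have "f \<noteq> 0" using less.prems by auto
  consider "degree f = 0" | "irreducible f" | "degree f > 0" "\<not> irreducible f" by blast
  then show ?case
  proof cases
    case 1
    then have "f = 1" using less.prems by (metis degree_0_id one_pCons)
    then show ?thesis by (intro exI[of _ "{#}"]) simp
  next
    case 2
    then show ?thesis using less.prems by (intro exI[of _ "{#f#}"]) simp
  next
    case 3
    then have "\<not> f dvd 1" using \<open>f \<noteq> 0\<close> by (simp add: is_unit_iff_degree)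
    then obtain a b where ab: "f = a * b" "\<not> a dvd 1" "\<not> b dvd 1"
      using 3(2) \<open>f \<noteq> 0\<close> unfolding irreducible_def by blast
    have nz: "a \<noteq> 0" "b \<noteq> 0" using ab(1) \<open>f \<noteq> 0\<close> by auto
    then have "degree a > 0" "degree b > 0" using ab by (auto simp: is_unit_iff_degree)
    moreover have "degree f = degree a + degree b" using nz ab(1) by (simp add: degree_mult_eq)
    ultimately have deg: "degree a < degree f" "degree b < degree f" by auto
    define c where "c = lead_coeff a"
    have c: "c \<noteq> 0" using nz by (simp add: c_def)
    \<comment> \<open>Moving the leading coefficient of \<open>a\<close> over to \<open>b\<close>
      makes both factors monic without changing their product or degrees.\<close>
    let ?a = "smult (inverse c) a" and ?b = "smult c b"
    have f: "f = ?a * ?b" using ab(1) c by simp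
    have "lead_coeff ?a = 1" using c by (simp add: c_def)
    moreover have "lead_coeff ?b = 1" using less.prems ab(1) nz by (simp add: c_def lead_coeff_mult)
    moreover have "degree ?a < degree f" "degree ?b < degree f" using deg c by simp_all
    ultimately obtain M N where
      "\<forall>p\<in>#M. irreducible p \<and> lead_coeff p = 1" "prod_mset M = ?a"
      "\<forall>p\<in>#N. irreducible p \<and> lead_coeff p = 1" "prod_mset N = ?b"
      using less.hyps[of ?a] less.hyps[of ?b] by blast
    then show ?thesis using f by (intro exI[of _ "M + N"]) auto
  qed
qed

lemma degree_prod_mset_eq_sum:
  fixes M :: "'a::field poly multiset"
  assumes "0 \<notin># M"
  shows "degree (prod_mset M) = (\<Sum>p\<in>#M. degree p)"
  using assms
proof (induction M)
  case (add p M)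
  then have "prod_mset M \<noteq> 0" "p \<noteq> 0" by auto
  then show ?case using add by (simp add: degree_mult_eq)
qed simp

section \<open>Bounds for the poset of monic polynomials\<close>

lemma degree_less_finite_card:
  fixes n :: nat
  shows "finite {f :: 'a::{zero,finite} poly. degree f < n}"
    and "card {f :: 'a poly. degree f < n} \<le> CARD('a) ^ n"
proof -
  let ?F = "{f :: 'a poly. degree f < n}" and ?L = "{xs :: 'a list. set xs \<subseteq> UNIV \<and> length xs = n}"
  let ?c = "\<lambda>f :: 'a poly. map (coeff f) [0..<n]"
  have inj: "inj_on ?c ?F"
  proof (rule inj_onI)
    fix f g :: "'a poly" assume fg: "f \<in> ?F" "g \<in> ?F" "?c f = ?c g"
    show "f = g"
    proof (rule poly_eqI)
      fix i
      show "coeff f i = coeff g i"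
        using fg by (cases "i < n") (auto simp: coeff_eq_0)
    qed
  qed
  have sub: "?c ` ?F \<subseteq> ?L" by auto
  have fin: "finite ?L" by (rule finite_lists_length_eq) simp
  show "finite ?F" using inj sub fin by (rule inj_on_finite)
  have "card ?F \<le> card ?L" using inj sub fin by (rule card_inj_on_le)
  then show "card ?F \<le> CARD('a) ^ n" using card_lists_length_eq[of "UNIV :: 'a set" n] by simp
qed

text \<open>Irreducibles of degree below \<open>j\<^sub>0\<close> form \<open>S\<^sub>0\<close> and
  those of degree from \<open>j\<^sub>0\<close> to \<delta> form \<open>S\<close>; both are counted
  crudely by all polynomials of such degrees. The term \<open>16 * k * N\<close> is two keys for
  each of 8k buckets in each of \<open>N\<close> distributions.\<close>

lemma dm_dim_monic_polys_le:
  fixes d\<^sub>0 \<delta> j\<^sub>0 N :: nat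
  defines "k \<equiv> \<delta> div j\<^sub>0"
  defines "P \<equiv> monic_polys (int d\<^sub>0 - int \<delta>) (int d\<^sub>0) :: 'a::{field,finite} poly set"
  assumes "j\<^sub>0 > 0" "k > 0" and N: "2 * (CARD('a) ^ Suc \<delta>) ^ (2 * k) < 2 ^ N"
  shows "dm_dim P (dvd_on P) \<le> 3 + (if j\<^sub>0 = 1 then 0 else CARD('a) ^ j\<^sub>0) + 16 * k * N"
proof -
  \<comment> \<open>Any choice of factorization serves:
    \<open>prod_mset_monic_irreducible_dvd_iff\<close> turns divisibility into inclusion for
    whichever multisets are chosen.\<close>
  define v where "v f = (SOME M. (\<forall>p\<in>#M. irreducible p \<and> lead_coeff p = 1) \<and> prod_mset M = f)"
    for f :: "'a poly"
  have v: "(\<forall>p\<in>#v f. irreducible p \<and> lead_coeff p = 1) \<and> prod_mset (v f) = f"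
    if "lead_coeff f = 1" for f
    unfolding v_def using monic_factorization_exists[OF that] by (rule someI_ex)
  define S\<^sub>0 where "S\<^sub>0 = {p :: 'a poly. irreducible p \<and> lead_coeff p = 1 \<and> degree p < j\<^sub>0}"
  define S where "S = {p :: 'a poly. irreducible p \<and> lead_coeff p = 1 \<and> j\<^sub>0 \<le> degree p \<and> degree p \<le> \<delta>}"
  have "S\<^sub>0 \<subseteq> {f. degree f < j\<^sub>0}" by (auto simp: S\<^sub>0_def)
  then have finS0: "finite S\<^sub>0" and card_S0: "card S\<^sub>0 \<le> CARD('a) ^ j\<^sub>0"
    using degree_less_finite_card(1)[where 'a = 'a, of j\<^sub>0] degree_less_finite_card(2)[where 'a = 'a, of j\<^sub>0]
    by (auto intro: finite_subset dest: card_mono[rotated])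
  have "S \<subseteq> {f. degree f < Suc \<delta>}" by (auto simp: S_def)
  then have finS: "finite S" and card_S: "card S \<le> CARD('a) ^ Suc \<delta>"
    using degree_less_finite_card(1)[where 'a = 'a, of "Suc \<delta>"] degree_less_finite_card(2)[where 'a = 'a, of "Suc \<delta>"]
    by (auto intro: finite_subset dest: card_mono[rotated])
  \<comment> \<open>Irreducibles are nonzero nonunits, so none has degree 0.\<close>
  have "S\<^sub>0 = {}" if "j\<^sub>0 = 1"
    using that by (auto simp: S\<^sub>0_def irreducible_def is_unit_iff_degree)
  then have card_S0': "card S\<^sub>0 \<le> (if j\<^sub>0 = 1 then 0 else CARD('a) ^ j\<^sub>0)" using card_S0 by simp
  have "2 * card S ^ (2 * k) < 2 ^ N"
    using power_mono[OF card_S, of "2 * k"] N by simp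
  then obtain hs :: "nat \<Rightarrow> 'a poly \<Rightarrow> nat" where
    range: "\<forall>j<N. \<forall>p\<in>S. hs j p < 8 * k"
    and isolate: "\<forall>p\<in>S. \<forall>X. X \<subseteq> S - {p} \<and> card X < 2 * k \<longrightarrow> (\<exists>j<N. hs j p \<notin> hs j ` X)"
    and spread: "\<forall>Y. Y \<subseteq> S \<and> card Y = 2 * k \<longrightarrow> (\<exists>j<N. k < card (hs j ` Y))"
    using hash_family_exists[OF finS \<open>k > 0\<close>] by blast
  have "N > 0" using N by (cases N) auto
  have monic: "lead_coeff f = 1" if "f \<in> P" for f using that by (simp add: P_def monic_polys_def)
  have deg: "(\<Sum>p\<in>#v f. degree p) = degree f" if "f \<in> P" for f
  proof -
    have "0 \<notin># v f" using v[OF monic[OF that]] by auto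
    then show ?thesis using degree_prod_mset_eq_sum[of "v f"] v[OF monic[OF that]] by simp
  qed
  have "dm_dim P (dvd_on P) \<le> 3 + card S\<^sub>0 + 2 * (N * (8 * k))"
  proof (rule dm_dim_le_of_hash_family[where v = v and w = degree and \<delta> = \<delta> and S = S
        and j\<^sub>0 = j\<^sub>0 and k = k and hs = hs])
    show "finite P" unfolding P_def by (rule finite_monic_polys)
    show "partial_order_on P (dvd_on P)" unfolding P_def by (rule partial_order_on_monic_polys)
    show "(f, g) \<in> dvd_on P \<longleftrightarrow> v f \<subseteq># v g" if "f \<in> P" "g \<in> P" for f g
      using that v[OF monic[OF that(1)]] v[OF monic[OF that(2)]]
        prod_mset_monic_irreducible_dvd_iff[of "v f" "v g"] by (simp add: dvd_on_def)
    show "(\<Sum>p\<in>#v g. degree p) \<le> (\<Sum>p\<in>#v f. degree p) + \<delta>" if "f \<in> P" "g \<in> P" for f g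
      using that unfolding deg[OF that(1)] deg[OF that(2)] by (auto simp: P_def monic_polys_def)
    show "\<delta> < degree p" if "f \<in> P" "p \<in># v f" "p \<notin> S\<^sub>0 \<union> S" for f p
      using that v[OF monic[OF that(1)]] by (auto simp: S\<^sub>0_def S_def)
  qed (use finS0 finS \<open>j\<^sub>0 > 0\<close> \<open>N > 0\<close> range isolate spread in \<open>auto simp: S\<^sub>0_def S_def k_def\<close>)
  also have "\<dots> \<le> 3 + (if j\<^sub>0 = 1 then 0 else CARD('a) ^ j\<^sub>0) + 16 * k * N"
    using card_S0' by simp
  finally show ?thesis .
qed

lemma dm_dim_monic_polys_real_le:
  fixes d\<^sub>0 \<delta> j\<^sub>0 :: nat
  defines "P \<equiv> monic_polys (int d\<^sub>0 - int \<delta>) (int d\<^sub>0) :: 'a::{field,finite} poly set"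
  assumes "j\<^sub>0 > 0" "j\<^sub>0 \<le> \<delta>"
  shows "real (dm_dim P (dvd_on P)) \<le> (if j\<^sub>0 = 1 then 0 else real (CARD('a) ^ j\<^sub>0))
    + 149 * (real \<delta> / real j\<^sub>0)\<^sup>2 * (real \<delta> * ln (real CARD('a)))"
proof -
  define k where "k = \<delta> div j\<^sub>0"
  define l where "l = ln (real CARD('a))"
  \<comment> \<open>\<open>2 powr X\<close> is the power of the field size to be exceeded. In
    \<open>N\<close>, one unit beyond the floor of \<open>X\<close> makes the inequality strict and
    the other absorbs the factor 2.\<close>
  define X where "X = real (Suc \<delta> * (2 * k)) * l / ln 2"
  define N where "N = 2 + nat \<lfloor>X\<rfloor>"
  have k: "k \<ge> 1" using assms(2,3) unfolding k_def by (simp add: div_greater_zero_iff Suc_le_eq)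
  have q: "CARD('a) \<ge> 2"
    using card_mono[of UNIV "{0, 1 :: 'a}"] by simp
  have l2: "ln 2 \<le> l" using q by (simp add: l_def)
  have ln2: "(2 / 3 :: real) \<le> ln 2" by (rule ln2_ge_two_thirds)
  have X0: "X \<ge> 0" using l2 ln2 unfolding X_def by simp
  have "real ((CARD('a) ^ Suc \<delta>) ^ (2 * k)) = real CARD('a) ^ (Suc \<delta> * (2 * k))"
    by (simp only: of_nat_power power_mult)
  also have "\<dots> = real CARD('a) powr real (Suc \<delta> * (2 * k))"
    using q by (intro powr_realpow[symmetric]) simp
  also have "\<dots> = 2 powr X" using q by (simp add: powr_def X_def l_def)
  also have "\<dots> < 2 powr (real (Suc (nat \<lfloor>X\<rfloor>)))"
    using X0 by (intro powr_less_mono) linarith+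
  also have "\<dots> = 2 ^ Suc (nat \<lfloor>X\<rfloor>)" by (rule powr_realpow) simp
  finally have "real ((CARD('a) ^ Suc \<delta>) ^ (2 * k)) < real (2 ^ Suc (nat \<lfloor>X\<rfloor>))" by simp
  then have "(CARD('a) ^ Suc \<delta>) ^ (2 * k) < 2 ^ Suc (nat \<lfloor>X\<rfloor>)" by (simp only: of_nat_less_iff)
  then have "2 * (CARD('a) ^ Suc \<delta>) ^ (2 * k) < 2 ^ N" unfolding N_def by simp
  then have "dm_dim P (dvd_on P) \<le> 3 + (if j\<^sub>0 = 1 then 0 else CARD('a) ^ j\<^sub>0) + 16 * k * N"
    unfolding P_def k_def using assms(2) k
    by (intro dm_dim_monic_polys_le) (auto simp: k_def)
  then have "real (dm_dim P (dvd_on P))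
      \<le> real (3 + (if j\<^sub>0 = 1 then 0 else CARD('a) ^ j\<^sub>0) + 16 * k * N)"
    by (simp only: of_nat_le_iff)
  also have "\<dots> = 3 + (if j\<^sub>0 = 1 then 0 else real (CARD('a) ^ j\<^sub>0)) + 16 * real k * real N" by simp
  finally have dim: "real (dm_dim P (dvd_on P)) \<le> \<dots>" .
  define Y where "Y = real k * (real \<delta> * l)"
  have \<delta>1: "1 \<le> real \<delta>" and k1: "1 \<le> real k" using assms(2,3) k by simp_all
  have "1 * (1 * ln 2) \<le> Y"
    unfolding Y_def using \<delta>1 k1 l2 ln2 by (intro mult_mono) auto
  then have Y1: "ln 2 \<le> Y" by simp
  \<comment> \<open>The 4 comes from \<open>Suc \<delta> \<le> 2 * \<delta>\<close> and the factor 2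
    in \<open>2 * k\<close>.\<close>
  have XY: "X * ln 2 \<le> 4 * Y"
  proof -
    have "real (Suc \<delta>) * (2 * real k * l) \<le> (2 * real \<delta>) * (2 * real k * l)"
      using \<delta>1 k1 l2 ln2 by (intro mult_right_mono) auto
    moreover have "X * ln 2 = real (Suc \<delta> * (2 * k)) * l"
      using ln2 nonzero_eq_divide_eq[of "ln 2" X] X_def by simp
    ultimately show ?thesis by (simp add: Y_def algebra_simps)
  qed
  have "real N \<le> 2 + X" using X0 unfolding N_def by linarith
  then have "real N * ln 2 \<le> (2 + X) * ln 2" using ln2 by (intro mult_right_mono) auto
  then have N6: "real N * ln 2 \<le> 6 * Y" using XY Y1 by (simp add: algebra_simps)
  have "real N * (2 / 3) \<le> real N * ln 2" using ln2 by (intro mult_left_mono) auto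
  \<comment> \<open>Since ln 2 is at least 2/3, dividing 6 by it gives at most 9. Then 16 * 9 = 144,
    and the additive 3 costs another 5, for a total of 149.\<close>
  then have N9: "real N \<le> 9 * Y" using N6 by simp
  have kY: "Y \<le> real k * Y" using k1 Y1 ln2 by simp
  have "16 * real k * real N \<le> 144 * (real k * Y)"
    using mult_left_mono[OF N9, of "16 * real k"] by (simp add: algebra_simps)
  moreover have "3 \<le> 5 * (real k * Y)" using kY Y1 ln2 by linarith
  ultimately have "real (dm_dim P (dvd_on P)) \<le> (if j\<^sub>0 = 1 then 0 else real (CARD('a) ^ j\<^sub>0))
      + 149 * (real k * Y)"
    using dim by linarith
  also have "real k * Y = (real k)\<^sup>2 * (real \<delta> * l)" by (simp add: Y_def power2_eq_square)
  also have "149 * \<dots> \<le> 149 * (real \<delta> / real j\<^sub>0)\<^sup>2 * (real \<delta> * l)"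
  proof -
    have "real k * real j\<^sub>0 \<le> real \<delta>"
      using div_times_less_eq_dividend[of \<delta> j\<^sub>0] by (simp only: k_def of_nat_le_iff flip: of_nat_mult)
    then have "real k \<le> real \<delta> / real j\<^sub>0" using assms(2) by (simp add: pos_le_divide_eq)
    then have "(real k)\<^sup>2 \<le> (real \<delta> / real j\<^sub>0)\<^sup>2" by (intro power_mono) auto
    then have "(real k)\<^sup>2 * (real \<delta> * l) \<le> (real \<delta> / real j\<^sub>0)\<^sup>2 * (real \<delta> * l)"
      using l2 ln2 by (intro mult_right_mono) auto
    then show ?thesis by simp
  qed
  finally show ?thesis by (simp add: l_def)
qed

theorem theorem1p9:
  fixes q \<delta> d\<^sub>0 :: nat
  assumes "primepow q"
    and "card (UNIV :: 'a::{field,finite} set) = q"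
    and "\<delta> > 0"
  shows "let P = (monic_polys (int d\<^sub>0 - int \<delta>) (int d\<^sub>0) :: 'a poly set) in
   real (dm_dim P (dvd_on P)) \<le>
    (if \<delta> = 1 then 172 * real \<delta> ^ 3 * ln (real q)
     else min (910 * ((real \<delta> * ln (real q)) ^ 3 / (ln (real \<delta>))\<^sup>2))
              (172 * real \<delta> ^ 3 * ln (real q)))"
proof -
  define P where "P = (monic_polys (int d\<^sub>0 - int \<delta>) (int d\<^sub>0) :: 'a poly set)"
  define l where "l = ln (real q)"
  define D where "D = real (dm_dim P (dvd_on P))"
  have "q \<ge> 2" using primepow_gt_Suc_0[OF assms(1)] by simp
  then have "ln 2 \<le> l" by (simp add: l_def)
  then have l: "2 / 3 \<le> l" using ln2_ge_two_thirds by linarith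
  have bound: "D \<le> (if j\<^sub>0 = 1 then 0 else real (q ^ j\<^sub>0)) + 149 * (real \<delta> / real j\<^sub>0)\<^sup>2 * (real \<delta> * l)"
    if "j\<^sub>0 > 0" "j\<^sub>0 \<le> \<delta>" for j\<^sub>0
    using dm_dim_monic_polys_real_le[where 'a = 'a, OF that, of d\<^sub>0]
    unfolding assms(2) D_def P_def l_def .
  \<comment> \<open>With \<open>j\<^sub>0 = 1\<close> every irreducible of degree at most \<delta>
    is hashed.\<close>
  have "D \<le> 149 * (real \<delta> ^ 3 * l)"
    using bound[of 1] assms(3) by (simp add: power2_eq_square power3_eq_cube mult.assoc)
  also have "\<dots> \<le> 172 * (real \<delta> ^ 3 * l)" using l by (intro mult_right_mono) auto
  finally have second: "D \<le> 172 * (real \<delta> ^ 3 * l)" .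
  have first: "D \<le> 910 * ((real \<delta> * l) ^ 3 / (ln (real \<delta>))\<^sup>2)" if "\<delta> \<noteq> 1"
  proof -
    have d2: "\<delta> \<ge> 2" using that assms(3) by simp
    define t where "t = ln (real \<delta>)"
    have t0: "t > 0" using d2 by (simp add: t_def)
    show ?thesis
    \<comment> \<open>For \<delta> below \<open>q\<close> the ratio of log q to log \<delta> is at
      least 1, so the second bound already implies the first.\<close>
    proof (cases "\<delta> < q")
      case True
      then have "t \<le> l" using d2 by (simp add: t_def l_def)
      then have "t\<^sup>2 \<le> l\<^sup>2" using t0 by (intro power_mono) auto
      then have "real \<delta> ^ 3 * l * t\<^sup>2 \<le> real \<delta> ^ 3 * l * l\<^sup>2" using l by (intro mult_left_mono) auto
      also have "\<dots> = (real \<delta> * l) ^ 3" by (simp add: power2_eq_square power3_eq_cube)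
      finally have "real \<delta> ^ 3 * l \<le> (real \<delta> * l) ^ 3 / t\<^sup>2" using t0 by (simp add: pos_le_divide_eq)
      moreover have "0 \<le> real \<delta> ^ 3 * l" using l by simp
      ultimately show ?thesis using second unfolding t_def by linarith
    next
      case False
      \<comment> \<open>This is the largest exponent with \<open>q ^ j \<le> \<delta>\<close>. As
        \<open>t / l \<ge> 1\<close>, rounding down loses at most a factor 2, whence
        \<open>t / l \<le> 2 * real j\<close>.\<close>
      define j where "j = nat \<lfloor>t / l\<rfloor>"
      have "l \<le> t" using False \<open>q \<ge> 2\<close> by (simp add: t_def l_def)
      then have tl: "1 \<le> t / l" using l by (simp add: pos_le_divide_eq)
      then have j1: "j \<ge> 1" unfolding j_def by linarith
      have jt: "real j \<le> t / l" using tl unfolding j_def by linarith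
      have tj: "t / l \<le> 2 * real j" using tl j1 unfolding j_def by linarith
      have "real j * l \<le> t" using jt l by (simp add: pos_le_divide_eq)
      then have "exp (real j * l) \<le> exp t" by simp
      then have qj: "real (q ^ j) \<le> real \<delta>"
        using \<open>q \<ge> 2\<close> d2 by (simp add: exp_of_nat_mult l_def t_def)
      have "j \<le> q ^ j" using \<open>q \<ge> 2\<close> less_exp[of j] power_mono[of 2 q j] by linarith
      moreover have "q ^ j \<le> \<delta>" using qj by (simp only: of_nat_le_iff)
      ultimately have "j \<le> \<delta>" by simp
      define Z where "Z = (real \<delta> * l) ^ 3 / t\<^sup>2"
      have "real \<delta> / real j \<le> 2 * real \<delta> * l / t"
      proof -
        have "t \<le> 2 * real j * l" using tj l by (simp add: pos_divide_le_eq)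
        then have "real \<delta> * t \<le> real \<delta> * (2 * real j * l)" by (intro mult_left_mono) auto
        then show ?thesis using t0 j1 by (simp add: field_simps)
      qed
      then have "(real \<delta> / real j)\<^sup>2 \<le> (2 * real \<delta> * l / t)\<^sup>2" by (intro power_mono) auto
      then have "149 * (real \<delta> / real j)\<^sup>2 * (real \<delta> * l) \<le> 149 * (2 * real \<delta> * l / t)\<^sup>2 * (real \<delta> * l)"
        using l by (intro mult_right_mono mult_left_mono) auto
      \<comment> \<open>149 times the square of the rounding factor 2.\<close>
      also have "\<dots> = 596 * Z"
        by (simp add: Z_def power2_eq_square power3_eq_cube field_simps)
      finally have main: "149 * (real \<delta> / real j)\<^sup>2 * (real \<delta> * l) \<le> 596 * Z" .
      \<comment> \<open>The term \<open>q ^ j \<le> \<delta>\<close> is absorbed through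
        \<open>t \<le> \<delta>\<close> and \<open>l ^ 3 \<ge> 8 / 27\<close>, as 27/8 is at most 4.
        The total 4 + 596 = 600 stays below 910.\<close>
      have "real \<delta> \<le> 4 * Z"
      proof -
        have "t \<le> real \<delta>" unfolding t_def using d2 ln_le_minus_one[of "real \<delta>"] by simp
        then have "t\<^sup>2 \<le> (real \<delta>)\<^sup>2" using t0 by (intro power_mono) auto
        moreover have "8 / 27 \<le> l ^ 3" using power_mono[OF l, of 3] by (simp add: power3_eq_cube)
        ultimately have "t\<^sup>2 * (8 / 27) \<le> (real \<delta>)\<^sup>2 * l ^ 3" by (intro mult_mono) auto
        moreover have "0 \<le> (real \<delta>)\<^sup>2 * l ^ 3" using l by simp
        ultimately have "t\<^sup>2 \<le> 4 * ((real \<delta>)\<^sup>2 * l ^ 3)" by linarith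
        then have "real \<delta> * t\<^sup>2 \<le> real \<delta> * (4 * ((real \<delta>)\<^sup>2 * l ^ 3))" by (intro mult_left_mono) auto
        also have "\<dots> = 4 * (real \<delta> * l) ^ 3" by (simp add: power2_eq_square power3_eq_cube)
        finally show ?thesis using t0 by (simp add: Z_def pos_le_divide_eq)
      qed
      moreover have "D \<le> real \<delta> + 149 * (real \<delta> / real j)\<^sup>2 * (real \<delta> * l)"
      proof -
        have "(if j = 1 then 0 else real (q ^ j)) \<le> real \<delta>" using qj by (simp del: of_nat_power)
        then show ?thesis using bound[of j] j1 \<open>j \<le> \<delta>\<close> by linarith
      qed
      moreover have "0 \<le> Z" using l by (simp add: Z_def)
      ultimately show ?thesis using main unfolding Z_def[symmetric] t_def[symmetric] by linarith
    qed
  qed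
  show ?thesis
    using first second unfolding Let_def P_def[symmetric] D_def[symmetric] l_def[symmetric]
    by (cases "\<delta> = 1") (simp_all add: mult.assoc)
qed

end
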